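(* Let $M\in\mathbb{R}^{p\times q}$ be nonzero with largest singular value $\sigma_1$, let $0<\alpha<2/\sigma_1^2$, and let $\{X_k\}_{k\ge0}\subset\mathbb{R}^{q\times p}$ be generated by $X_0=\alpha M^T$, $X_{k+1}=X_k(2I_p-MX_k)=2X_k-X_kMX_k$. Define $$E_k:=X_k-M^\dagger,\qquad R_k:=MX_kM-M .$$ Then for every $k\ge0$ $$E_k=M^\dagger R_kM^\dagger .$$ Consequently, $$\|X_k-M^\dagger\|_F\leq\|M^\dagger\|_2^2\,\|MX_kM-M\|_F .$$ Equivalently, $$\frac{\|X_k-M^\dagger\|_F}{\|M^\dagger\|_F}\leq\frac{\|M^\dagger\|_2^2\|M\|_F}{\|M^\dagger\|_F}\,\frac{\|MX_kM-M\|_F}{\|M\|_F}.$$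
   Context: $M^\dagger$ is the usual Moore--Penrose inverse of a real matrix; $\|\cdot\|_2$ is the spectral norm and $\|\cdot\|_F$ the Frobenius norm. *)

theory Defs
  imports "HOL-Analysis.Analysis"
begin

text \<open>
  A matrix with \<open>p\<close> rows and \<open>q\<close> columns is an element of \<^typ>\<open>real^'q^'p\<close>: the row index
  type comes last.
\<close>

definition is_moore_penrose :: "real^'q^'p \<Rightarrow> real^'p^'q \<Rightarrow> bool" where
  "is_moore_penrose M P \<longleftrightarrow>
     M ** P ** M = M \<and>
     P ** M ** P = P \<and>
     transpose (M ** P) = M ** P \<and>
     transpose (P ** M) = P ** M"

definition moore_penrose :: "real^'q^'p \<Rightarrow> real^'p^'q" where
  "moore_penrose M = (THE P. is_moore_penrose M P)"

definition spectral_norm :: "real^'q^'p \<Rightarrow> real" where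
  "spectral_norm M = onorm (\<lambda>x. M *v x)"

definition frobenius_norm :: "real^'q^'p \<Rightarrow> real" where
  "frobenius_norm M = sqrt (\<Sum>i\<in>UNIV. \<Sum>j\<in>UNIV. (M $ i $ j)\<^sup>2)"

lemma frobenius_norm_eq_norm: "frobenius_norm M = norm M"
  by (simp add: frobenius_norm_def norm_vec_def L2_set_def sum_nonneg)

text \<open>
  Square roots of the eigenvalues of \<open>M\<^sup>T M\<close>.  If \<open>q > p\<close>, this set contains \<open>0\<close> even when the
  list of \<open>min p q\<close> singular values does not; the largest one is unaffected.
\<close>

definition singular_values :: "real^'q^'p \<Rightarrow> real set" where
  "singular_values M =
     {sqrt l |l. \<exists>v. v \<noteq> 0 \<and> (transpose M ** M) *v v = l *\<^sub>R v}"

definition largest_singular_value :: "real^'q^'p \<Rightarrow> real" where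
  "largest_singular_value M = Max (singular_values M)"

end

theory Submission
  imports Defs
begin

text \<open>
  The iterates keep their row space and column space: \<open>M\<^sup>T = M\<^sup>\<dagger> M M\<^sup>T = M\<^sup>T M M\<^sup>\<dagger>\<close>, and the recursion
  preserves \<open>X = M\<^sup>\<dagger> M X = X M M\<^sup>\<dagger>\<close>.  Hence \<open>M\<^sup>\<dagger> (M X\<^sub>k M - M) M\<^sup>\<dagger> = X\<^sub>k - M\<^sup>\<dagger>\<close>, and the bounds follow from
  \<open>\<parallel>A B\<parallel>\<^sub>F \<le> \<parallel>A\<parallel>\<^sub>2 \<parallel>B\<parallel>\<^sub>F\<close> and \<open>\<parallel>A B\<parallel>\<^sub>F \<le> \<parallel>A\<parallel>\<^sub>F \<parallel>B\<parallel>\<^sub>2\<close>.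
\<close>

lemma matrix_sub_ldistrib: "A ** (B - C) = A ** B - A ** (C :: 'a::ring_1^'n^'m)"
  by (simp add: matrix_matrix_mult_def vec_eq_iff right_diff_distrib sum_subtractf)

lemma matrix_sub_rdistrib: "(A - B) ** C = A ** C - B ** (C :: 'a::ring_1^'n^'m)"
  by (simp add: matrix_matrix_mult_def vec_eq_iff left_diff_distrib sum_subtractf)

text \<open>A linear map has a linear right inverse on its range; the matrix of that right inverse
  serves as \<open>G\<close>.\<close>

lemma inner_inverse_exists:
  fixes M :: "real^'q^'p"
  shows "\<exists>G. M ** G ** M = M"
proof -
  obtain g where g: "linear g" "\<forall>v\<in>range ((*v) M). M *v g v = v"
    using linear_exists_right_inverse_on[OF matrix_vector_mul_linear subspace_UNIV, of M] by blast
  have "(M ** matrix g ** M) *v x = M *v x" for x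
    using g by (simp flip: matrix_vector_mul_assoc add: matrix_works)
  then show ?thesis
    by (metis matrix_eq)
qed

text \<open>If M^T M y = 0, then |M y|^2 = y . M^T M y = 0, so M^T M and M have the same kernel.
  This is applied to every vector y in the range of \<open>B - C\<close>.\<close>

lemma transpose_mult_self_cancel:
  fixes M :: "real^'q^'p" and B C :: "real^'n^'q"
  assumes "transpose M ** M ** B = transpose M ** M ** C"
  shows "M ** B = M ** C"
proof -
  have "M *v ((B - C) *v x) = 0" for x
  proof -
    let ?y = "(B - C) *v x"
    have "transpose M ** M ** (B - C) = 0"
      using assms by (simp add: matrix_sub_ldistrib)
    then have "transpose M *v (M *v ?y) = 0"
      by (simp add: matrix_vector_mul_assoc matrix_mul_assoc)
    then have "(M *v ?y) \<bullet> (M *v ?y) = 0"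
      by (metis dot_lmul_matrix inner_zero_left transpose_matrix_vector transpose_transpose)
    then show ?thesis by simp
  qed
  then have "M ** (B - C) = 0"
    by (simp add: matrix_eq matrix_vector_mul_assoc)
  then show ?thesis
    by (simp add: matrix_sub_ldistrib)
qed

text \<open>The witness is H = G M^T with G an inner inverse of M^T M, as in the normal equations; M
  H is then the orthogonal projection onto the range of M.\<close>

lemma least_squares_inverse_exists:
  fixes M :: "real^'q^'p"
  shows "\<exists>H. M ** H ** M = M \<and> transpose (M ** H) = M ** H"
proof -
  obtain G where G: "(transpose M ** M) ** G ** (transpose M ** M) = transpose M ** M"
    using inner_inverse_exists by blast
  let ?Q = "M ** G ** transpose M"
  have QM: "?Q ** M = M"
    using transpose_mult_self_cancel[of M "G ** transpose M ** M" "mat 1"] G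
    by (simp add: matrix_mul_assoc)
  \<comment> \<open>Q^T = M G^T M^T starts with M, which Q fixes. The left side is symmetric, hence
    so is Q, although G itself need not be.\<close>
  have "?Q ** transpose ?Q = transpose ?Q"
    using QM by (simp add: matrix_transpose_mul matrix_mul_assoc)
  then have "transpose ?Q = ?Q"
    by (metis matrix_transpose_mul transpose_transpose)
  with QM show ?thesis
    by (intro exI[of _ "G ** transpose M"]) (simp add: matrix_mul_assoc)
qed

text \<open>H makes M H symmetric, and K, obtained by transposing such an inverse of M^T, makes K M
  symmetric. The product K M H inherits both, since M (K M H) = M H and (K M H) M = K M.\<close>

lemma is_moore_penrose_exists:
  fixes M :: "real^'q^'p"
  shows "\<exists>P. is_moore_penrose M P"
proof -
  obtain H where H: "M ** H ** M = M" "transpose (M ** H) = M ** H"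
    using least_squares_inverse_exists by blast
  obtain L where L: "transpose M ** L ** transpose M = transpose M"
      "transpose (transpose M ** L) = transpose M ** L"
    using least_squares_inverse_exists by blast
  define K where "K = transpose L"
  have K: "M ** K ** M = M" "transpose (K ** M) = K ** M"
    using arg_cong[OF L(1), of transpose] L(2)
    by (simp_all add: K_def matrix_transpose_mul matrix_mul_assoc)
  have "M ** (K ** M ** H) = M ** H" "(K ** M ** H) ** M = K ** M"
    using H(1) K(1) by (metis matrix_mul_assoc)+
  moreover have "K ** M ** (K ** M ** H) = K ** M ** H"
    using K(1) by (metis matrix_mul_assoc)
  ultimately have "is_moore_penrose M (K ** M ** H)"
    using H K by (simp add: is_moore_penrose_def)
  then show ?thesis ..
qed

text \<open>M P and M Q are symmetric and each absorbs the other, being orthogonal projections onto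
  the range of M, so they agree; likewise P M = Q M. Then P = P M P = Q M P = Q M Q = Q.\<close>

lemma is_moore_penrose_unique:
  assumes P: "is_moore_penrose M P" and Q: "is_moore_penrose M Q"
  shows "P = Q"
proof -
  note P' = P[unfolded is_moore_penrose_def] and Q' = Q[unfolded is_moore_penrose_def]
  have "M ** P = (M ** Q) ** (M ** P)"
    using Q' by (simp add: matrix_mul_assoc)
  also have "\<dots> = transpose ((M ** P) ** (M ** Q))"
    using P' Q' by (simp add: matrix_transpose_mul)
  also have "\<dots> = M ** Q"
    using P' Q' by (simp add: matrix_mul_assoc)
  finally have left: "M ** P = M ** Q" .
  have "P ** M = (P ** M) ** (Q ** M)"
    using Q' by (metis matrix_mul_assoc)
  also have "\<dots> = transpose ((Q ** M) ** (P ** M))"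
    using P' Q' by (simp add: matrix_transpose_mul)
  also have "\<dots> = Q ** M"
    using P' Q' by (metis matrix_mul_assoc)
  finally have right: "P ** M = Q ** M" .
  have "P = P ** M ** P" using P' by simp
  also have "\<dots> = Q ** M ** Q" using left right by (metis matrix_mul_assoc)
  finally show ?thesis using Q' by simp
qed

lemma is_moore_penrose_moore_penrose: "is_moore_penrose M (moore_penrose M)"
  unfolding moore_penrose_def
  by (rule theI') (use is_moore_penrose_exists is_moore_penrose_unique in blast)

lemma norm_matrix_vector_mult_le: "norm (A *v x) \<le> spectral_norm A * norm x"
  unfolding spectral_norm_def by (rule onorm) simp

lemma spectral_norm_nonneg: "0 \<le> spectral_norm A"
  unfolding spectral_norm_def by (rule onorm_pos_le) simp

text \<open>For z = A^T y, Cauchy-Schwarz gives |z|^2 = y . A z \<le> |y| |A| |z|, with |A| the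
  spectral norm; cancel |z| when it is nonzero.\<close>

lemma spectral_norm_transpose_le: "spectral_norm (transpose A) \<le> spectral_norm A"
proof -
  have "norm (transpose A *v y) \<le> spectral_norm A * norm y" for y
  proof -
    let ?z = "transpose A *v y"
    have "norm ?z * norm ?z = y \<bullet> (A *v ?z)"
      by (metis dot_lmul_matrix power2_eq_square power2_norm_eq_inner transpose_matrix_vector)
    also have "\<dots> \<le> norm y * (spectral_norm A * norm ?z)"
      by (meson norm_cauchy_schwarz norm_matrix_vector_mult_le mult_left_mono norm_ge_zero order_trans)
    finally have "norm ?z * norm ?z \<le> (spectral_norm A * norm y) * norm ?z"
      by (simp add: algebra_simps)
    then show ?thesis
      using spectral_norm_nonneg[of A] by (cases "?z = 0") auto
  qed
  then show ?thesis
    unfolding spectral_norm_def[of "transpose A"] by (rule onorm_le)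
qed

lemma frobenius_norm_sq: "(frobenius_norm M)\<^sup>2 = (\<Sum>i\<in>UNIV. (norm (M $ i))\<^sup>2)"
  unfolding frobenius_norm_eq_norm by (simp add: norm_vec_def[of M] L2_set_def sum_nonneg)

lemma frobenius_norm_transpose: "frobenius_norm (transpose M) = frobenius_norm M"
  unfolding frobenius_norm_def transpose_def by (simp, rule sum.swap)

lemma frobenius_norm_nonneg: "0 \<le> frobenius_norm M"
  by (simp add: frobenius_norm_eq_norm)

text \<open>Row i of A B is B^T applied to row i of A, so each row grows by at most the spectral
  norm of B; sum the squares over the rows.\<close>

lemma frobenius_norm_mult_right:
  fixes A :: "real^'q^'p" and B :: "real^'n^'q"
  shows "frobenius_norm (A ** B) \<le> frobenius_norm A * spectral_norm B"
proof (rule power2_le_imp_le)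
  have "(A ** B) $ i = transpose B *v (A $ i)" for i
    by (simp add: matrix_matrix_mult_def matrix_vector_mult_def transpose_def vec_eq_iff mult.commute)
  moreover have "norm (transpose B *v (A $ i)) \<le> spectral_norm B * norm (A $ i)" for i
    by (meson norm_matrix_vector_mult_le spectral_norm_transpose_le mult_right_mono norm_ge_zero order_trans)
  ultimately have "(norm ((A ** B) $ i))\<^sup>2 \<le> (norm (A $ i))\<^sup>2 * (spectral_norm B)\<^sup>2" for i
    by (metis mult.commute norm_ge_zero power_mono power_mult_distrib)
  then show "(frobenius_norm (A ** B))\<^sup>2 \<le> (frobenius_norm A * spectral_norm B)\<^sup>2"
    unfolding power_mult_distrib frobenius_norm_sq sum_distrib_right by (rule sum_mono)
qed (simp add: frobenius_norm_nonneg spectral_norm_nonneg)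

lemma frobenius_norm_mult_left:
  fixes A :: "real^'q^'p" and B :: "real^'n^'q"
  shows "frobenius_norm (A ** B) \<le> spectral_norm A * frobenius_norm B"
proof -
  have "frobenius_norm (A ** B) = frobenius_norm (transpose B ** transpose A)"
    by (metis frobenius_norm_transpose matrix_transpose_mul)
  also have "\<dots> \<le> frobenius_norm B * spectral_norm (transpose A)"
    by (metis frobenius_norm_mult_right frobenius_norm_transpose)
  also have "\<dots> \<le> frobenius_norm B * spectral_norm A"
    by (intro mult_left_mono spectral_norm_transpose_le frobenius_norm_nonneg)
  finally show ?thesis by (simp add: mult.commute)
qed

text \<open>Transpose M P M = M, using the symmetry of P M for the first identity and of M P for the
  second. This supplies the base case for the iterates.\<close>

lemma moore_penrose_absorb_transpose:
  assumes "is_moore_penrose M P"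
  shows "P ** M ** transpose M = transpose M" "transpose M ** M ** P = transpose M"
proof -
  note P = assms[unfolded is_moore_penrose_def]
  have "P ** M ** transpose M = transpose (M ** (P ** M))"
    using P by (metis matrix_transpose_mul)
  then show "P ** M ** transpose M = transpose M"
    using P by (simp add: matrix_mul_assoc)
  have "transpose M ** (M ** P) = transpose (M ** P ** M)"
    using P by (metis matrix_transpose_mul)
  then show "transpose M ** M ** P = transpose M"
    using P by (simp add: matrix_mul_assoc)
qed

theorem theorem4p4:
  fixes M :: "real^'q^'p"
    and \<alpha> :: real
    and X E :: "nat \<Rightarrow> real^'p^'q"
    and R :: "nat \<Rightarrow> real^'q^'p"
  assumes "M \<noteq> 0"
    and "0 < \<alpha>" and "\<alpha> < 2 / (largest_singular_value M)\<^sup>2"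
    and "X 0 = \<alpha> *\<^sub>R transpose M"
    and "\<And>k. X (Suc k) = X k ** (2 *\<^sub>R mat 1 - M ** X k)"
    and "\<And>k. E k = X k - moore_penrose M"
    and "\<And>k. R k = M ** X k ** M - M"
  shows "\<forall>k.
    X (Suc k) = 2 *\<^sub>R X k - X k ** M ** X k \<and>
    E k = moore_penrose M ** R k ** moore_penrose M \<and>
    frobenius_norm (X k - moore_penrose M)
      \<le> (spectral_norm (moore_penrose M))\<^sup>2 * frobenius_norm (M ** X k ** M - M) \<and>
    frobenius_norm (X k - moore_penrose M) / frobenius_norm (moore_penrose M)
      \<le> ((spectral_norm (moore_penrose M))\<^sup>2 * frobenius_norm M / frobenius_norm (moore_penrose M))
         * (frobenius_norm (M ** X k ** M - M) / frobenius_norm M)"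
proof -
  define P where "P = moore_penrose M"
  have mp: "is_moore_penrose M P"
    unfolding P_def by (rule is_moore_penrose_moore_penrose)
  then have MPM: "M ** P ** M = M" and PMP: "P ** M ** P = P"
    by (simp_all add: is_moore_penrose_def)
  have step: "X (Suc k) = 2 *\<^sub>R X k - X k ** M ** X k" for k
    using assms(5)[of k]
    by (simp add: matrix_sub_ldistrib matrix_scalar_ac matrix_mul_assoc flip: scalar_matrix_assoc)
  have inv: "P ** M ** X k = X k \<and> X k ** M ** P = X k" for k
  proof (induction k)
    case 0
    then show ?case
      using moore_penrose_absorb_transpose[OF mp] assms(4)
      by (simp add: matrix_scalar_ac flip: scalar_matrix_assoc)
  next
    case (Suc k)
    \<comment> \<open>Products are normalized to the left, which hides the factor X M P of the
      induction hypothesis; this regrouping exposes it.\<close>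
    have "X k ** M ** X k ** M ** P = X k ** M ** (X k ** M ** P)"
      by (simp add: matrix_mul_assoc)
    with Suc show ?case
      unfolding step
      by (simp add: matrix_sub_ldistrib matrix_sub_rdistrib matrix_mul_assoc matrix_scalar_ac
          flip: scalar_matrix_assoc)
  qed
  have err: "X k - P = P ** (M ** X k ** M - M) ** P" for k
  proof -
    have "P ** (M ** X k ** M) ** P = (P ** M ** X k) ** M ** P"
      by (simp add: matrix_mul_assoc)
    then show ?thesis
      using inv[of k] PMP by (simp add: matrix_sub_ldistrib matrix_sub_rdistrib)
  qed
  have bound: "frobenius_norm (X k - P) \<le> (spectral_norm P)\<^sup>2 * frobenius_norm (M ** X k ** M - M)" for k
  proof -
    let ?R = "M ** X k ** M - M"
    have "frobenius_norm (X k - P) \<le> frobenius_norm (P ** ?R) * spectral_norm P"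
      unfolding err[of k] by (rule frobenius_norm_mult_right)
    also have "\<dots> \<le> spectral_norm P * frobenius_norm ?R * spectral_norm P"
      by (intro mult_right_mono frobenius_norm_mult_left spectral_norm_nonneg)
    finally show ?thesis
      by (simp add: power2_eq_square mult.commute mult.left_commute)
  qed
  \<comment> \<open>This lets the norm of M cancel in the relative bound. Dividing by
    \<open>frobenius_norm P\<close> uses only its nonnegativity, as x / 0 = 0.\<close>
  have "frobenius_norm M \<noteq> 0"
    using assms(1) by (simp add: frobenius_norm_eq_norm)
  then have "frobenius_norm (X k - P) / frobenius_norm P
      \<le> ((spectral_norm P)\<^sup>2 * frobenius_norm M / frobenius_norm P)
         * (frobenius_norm (M ** X k ** M - M) / frobenius_norm M)" for k
    using divide_right_mono[OF bound[of k] frobenius_norm_nonneg[of P]] by simp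
  with step err bound assms(6,7) show ?thesis
    unfolding P_def by simp
qed

end
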